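(* Let $\mu$ be a positive integer and let $a,b$ be nonnegative integers. There exists a $(2^{(a)},3^{(b)})$-CD of $\mu K_3$ if and only if $2a+3b=3\mu$.
   Context: All graphs are finite, loopless and undirected, possibly with multiple (parallel) edges. $\mu K_3$ denotes the multigraph on 3 vertices in which every two distinct vertices are joined by exactly $\mu$ edges. A cycle of length $c\ge 2$ is a connected 2-regular graph with $c$ edges (a cycle of length 2 consists of two distinct parallel edges between two vertices). A decomposition of a graph is a collection of its subgraphs whose edge sets partition its edge set. A $(2^{(a)},3^{(b)})$-CD of $\mu K_3$ is a decomposition of $\mu K_3$ (all of whose vertex degrees are even) into $a$ cycles of length 2 and $b$ cycles of length 3. *)

theory Defs
  imports Main "HOL-Library.Disjoint_Sets"
begin

text \<open>Multigraphs: edges have an identity of their own, so parallel edges are distinct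
  elements of \<open>edges G\<close> with the same set of ends.\<close>

record ('v, 'e) mgraph =
  verts :: "'v set"
  edges :: "'e set"
  ends :: "'e \<Rightarrow> 'v set"

text \<open>Finite and loopless: every edge has two distinct ends.\<close>

definition multigraph :: "('v, 'e) mgraph \<Rightarrow> bool" where
  "multigraph G \<longleftrightarrow> finite (verts G) \<and> finite (edges G) \<and>
     (\<forall>e\<in>edges G. ends G e \<subseteq> verts G \<and> card (ends G e) = 2)"

definition edges_between :: "('v, 'e) mgraph \<Rightarrow> 'v \<Rightarrow> 'v \<Rightarrow> 'e set" where
  "edges_between G u v = {e \<in> edges G. ends G e = {u, v}}"

definition degree :: "('v, 'e) mgraph \<Rightarrow> 'v \<Rightarrow> nat" where
  "degree G v = card {e \<in> edges G. v \<in> ends G e}"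

definition connected :: "('v, 'e) mgraph \<Rightarrow> bool" where
  "connected G \<longleftrightarrow> verts G \<noteq> {} \<and>
     (\<forall>u\<in>verts G. \<forall>v\<in>verts G. (\<lambda>x y. edges_between G x y \<noteq> {})\<^sup>*\<^sup>* u v)"

text \<open>A subgraph keeps the whole incidence function (also outside its own edge set), so that
  each subgraph of \<open>G\<close> is represented by exactly one record.\<close>

definition subgraph :: "('v, 'e) mgraph \<Rightarrow> ('v, 'e) mgraph \<Rightarrow> bool" where
  "subgraph H G \<longleftrightarrow> multigraph H \<and> verts H \<subseteq> verts G \<and> edges H \<subseteq> edges G \<and> ends H = ends G"

definition cycle_of_length :: "nat \<Rightarrow> ('v, 'e) mgraph \<Rightarrow> bool" where
  "cycle_of_length c G \<longleftrightarrow> c \<ge> 2 \<and> multigraph G \<and> connected G \<and>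
     (\<forall>v\<in>verts G. degree G v = 2) \<and> card (edges G) = c"

text \<open>Injectivity of \<open>edges\<close> on \<open>D\<close> ensures that different members of \<open>D\<close> give different
  blocks of the partition.\<close>

definition decomposition :: "('v, 'e) mgraph \<Rightarrow> ('v, 'e) mgraph set \<Rightarrow> bool" where
  "decomposition G D \<longleftrightarrow> (\<forall>H\<in>D. subgraph H G) \<and> inj_on edges D \<and>
     partition_on (edges G) (edges ` D)"

text \<open>\<open>D\<close> is a $(2^{(a)},3^{(b)})$-CD of \<open>G\<close>.\<close>

definition CD_2_3 :: "nat \<Rightarrow> nat \<Rightarrow> ('v, 'e) mgraph \<Rightarrow> ('v, 'e) mgraph set \<Rightarrow> bool" where
  "CD_2_3 a b G D \<longleftrightarrow> decomposition G D \<and>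
     (\<forall>H\<in>D. cycle_of_length 2 H \<or> cycle_of_length 3 H) \<and>
     card {H \<in> D. cycle_of_length 2 H} = a \<and>
     card {H \<in> D. cycle_of_length 3 H} = b"

text \<open>\<open>G\<close> is (a copy of) $\mu K_3$.\<close>

definition is_mu_K3 :: "nat \<Rightarrow> ('v, 'e) mgraph \<Rightarrow> bool" where
  "is_mu_K3 \<mu> G \<longleftrightarrow> multigraph G \<and> card (verts G) = 3 \<and>
     (\<forall>u\<in>verts G. \<forall>v\<in>verts G. u \<noteq> v \<longrightarrow> card (edges_between G u v) = \<mu>)"

lemma mu_K3_exists: "\<exists>G :: (nat, nat set \<times> nat) mgraph. is_mu_K3 \<mu> G"
proof -
  define G :: "(nat, nat set \<times> nat) mgraph" where
    "G = \<lparr>verts = {0, 1, 2}, edges = {S. S \<subseteq> {0, 1, 2} \<and> card S = 2} \<times> {..<\<mu>}, ends = fst\<rparr>"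
  have "card (edges_between G u v) = \<mu>"
    if "u \<in> verts G" "v \<in> verts G" "u \<noteq> v" for u v
  proof -
    have "{u, v} \<subseteq> {0, 1, 2}" "card {u, v} = 2"
      using that by (simp_all add: G_def)
    then have "edges_between G u v = {{u, v}} \<times> {..<\<mu>}"
      unfolding G_def edges_between_def by fastforce
    then show ?thesis
      by simp
  qed
  moreover have "multigraph G"
  proof -
    have "finite {S. S \<subseteq> {0, 1, 2 :: nat} \<and> card S = 2}"
      by (rule finite_subset[of _ "Pow {0, 1, 2}"]) (blast, simp)
    then have "finite (edges G)"
      by (simp add: G_def del: Collect_conj_eq)
    moreover have "ends G e \<subseteq> verts G \<and> card (ends G e) = 2" if "e \<in> edges G" for e
      using that by (cases e) (simp add: G_def)
    ultimately show ?thesis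
      by (simp add: multigraph_def G_def)
  qed
  moreover have "card (verts G) = 3"
    unfolding G_def by simp
  ultimately show ?thesis
    unfolding is_mu_K3_def by blast
qed

end

theory Submission imports Defs begin

text \<open>Necessity is a count of edges: $\mu K_3$ has $3\mu$ of them, and the cycles of the
  decomposition account for $2a + 3b$ (\<open>card_edges_CD_2_3\<close>, \<open>card_edges_mu_K3\<close>).

  For sufficiency, $3(\mu - b) = 2a$ makes $\mu - b$ an even nonnegative number, say $2k$, and then
  $a = 3k$. Choose $b$ edges out of each of the three parallel classes; these form $b$
  edge-disjoint triangles (\<open>CD_2_3_triangles\<close>). Each class retains $2k$ parallel edges, which pair
  up into $k$ cycles of length 2 (\<open>CD_2_3_parallel\<close>). In \<open>CD_2_3_mu_K3\<close> the pieces are put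
  together by \<open>CD_2_3_Un\<close>: decompositions of edge-disjoint spanning subgraphs unite to a decomposition of
  the union, and the numbers of cycles add.

  Spanning subgraphs are written \<open>G\<lparr>edges := F\<rparr>\<close>, so that all pieces share the vertex set and
  the incidence function of \<open>G\<close>.\<close>

section \<open>Counting edges\<close>

lemma cycle_lengths_exclusive: "cycle_of_length c H \<Longrightarrow> cycle_of_length d H \<Longrightarrow> c = d"
  by (simp add: cycle_of_length_def)

text \<open>Every edge lies in exactly one cycle of the decomposition, and \<open>edges\<close> is injective on it,
  so the number of edges is the sum of the lengths of the cycles.\<close>

lemma card_edges_CD_2_3:
  assumes CD: "CD_2_3 a b G D" and fin: "finite (edges G)"
  shows "card (edges G) = 2 * a + 3 * b"
proof -
  let ?D2 = "{H \<in> D. cycle_of_length 2 H}" and ?D3 = "{H \<in> D. cycle_of_length 3 H}"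
  have dec: "decomposition G D" and D: "D = ?D2 \<union> ?D3"
    and card: "card ?D2 = a" "card ?D3 = b"
    using CD by (auto simp: CD_2_3_def)
  have part: "partition_on (edges G) (edges ` D)" and inj: "inj_on edges D"
    using dec by (auto simp: decomposition_def)
  have finD: "finite D"
    using finite_elements[OF fin part] inj by (rule finite_imageD)
  have "card (edges G) = (\<Sum>S\<in>edges ` D. card S)"
  proof -
    have "finite S" if "S \<in> edges ` D" for S
      using part fin that by (metis Union_upper finite_subset partition_onD1)
    then show ?thesis
      using card_Union_disjoint[of "edges ` D"] partition_onD1[OF part] partition_onD2[OF part]
      by (simp add: disjoint_def pairwise_def disjnt_def)
  qed
  also have "\<dots> = (\<Sum>H\<in>D. card (edges H))"
    using inj by (simp add: sum.reindex)
  also have "\<dots> = (\<Sum>H\<in>?D2. card (edges H)) + (\<Sum>H\<in>?D3. card (edges H))"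
    using finD by (subst D, subst sum.union_disjoint) (auto dest: cycle_lengths_exclusive)
  also have "\<dots> = 2 * a + 3 * b"
  proof -
    have "(\<Sum>H\<in>?D2. card (edges H)) = (\<Sum>H\<in>?D2. 2)" "(\<Sum>H\<in>?D3. card (edges H)) = (\<Sum>H\<in>?D3. 3)"
      by (rule sum.cong; simp add: cycle_of_length_def)+
    then show ?thesis
      by (simp add: card)
  qed
  finally show ?thesis .
qed

lemma pair_among_three:
  assumes "u \<in> {x, y, z}" "v \<in> {x, y, z}" "u \<noteq> v"
  shows "{u, v} \<in> {{x, y}, {y, z}, {x, z}}"
  using assms by (auto simp: insert_commute)

lemma edges_three_vertices:
  assumes "multigraph G" "verts G = {x, y, z}"
  shows "edges G = edges_between G x y \<union> edges_between G y z \<union> edges_between G x z"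
proof -
  have "ends G e \<in> {{x, y}, {y, z}, {x, z}}" if "e \<in> edges G" for e
  proof -
    have "ends G e \<subseteq> {x, y, z}" "card (ends G e) = 2"
      using assms that by (auto simp: multigraph_def)
    then obtain u v where "ends G e = {u, v}" "u \<noteq> v" "u \<in> {x, y, z}" "v \<in> {x, y, z}"
      by (metis card_2_iff insert_subset)
    then show ?thesis
      using pair_among_three by simp
  qed
  then show ?thesis
    unfolding edges_between_def by blast
qed

lemma edges_between_disjoint:
  assumes "x \<noteq> y" "y \<noteq> z" "x \<noteq> z"
  shows "edges_between G x y \<inter> edges_between G y z = {}"
    "edges_between G y z \<inter> edges_between G x z = {}"
    "edges_between G x y \<inter> edges_between G x z = {}"
  using assms by (auto simp: edges_between_def doubleton_eq_iff)

lemma card_edges_mu_K3: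
  assumes "is_mu_K3 \<mu> G"
  shows "card (edges G) = 3 * \<mu>"
proof -
  obtain x y z where V: "verts G = {x, y, z}" and ne: "x \<noteq> y" "y \<noteq> z" "x \<noteq> z"
    using assms by (auto simp: is_mu_K3_def card_3_iff)
  have "finite (edges_between G u v)" for u v
    using assms by (auto simp: is_mu_K3_def multigraph_def edges_between_def)
  moreover have "card (edges_between G x y) = \<mu>" "card (edges_between G y z) = \<mu>"
    "card (edges_between G x z) = \<mu>"
    using assms V ne by (auto simp: is_mu_K3_def)
  moreover have "edges_between G x y \<inter> edges_between G y z = {}"
    "(edges_between G x y \<union> edges_between G y z) \<inter> edges_between G x z = {}"
    using edges_between_disjoint[OF ne, of G] by auto
  ultimately show ?thesis
    using edges_three_vertices[of G x y z] assms V
    by (simp add: is_mu_K3_def card_Un_disjoint)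
qed

section \<open>Uniting decompositions\<close>

lemma CD_2_3_empty: "CD_2_3 0 0 (G\<lparr>edges := {}\<rparr>) {}"
  by (simp add: CD_2_3_def decomposition_def partition_on_def)

text \<open>The two collections share no cycle, since a common one would have no edges; this is what
  makes both the injectivity of \<open>edges\<close> and the cycle counts pass to the union.\<close>

lemma CD_2_3_Un:
  assumes CD: "CD_2_3 a b (G\<lparr>edges := E\<rparr>) D" "CD_2_3 a' b' (G\<lparr>edges := E'\<rparr>) D'"
    and fin: "finite E" "finite E'" and disj: "E \<inter> E' = {}"
  shows "CD_2_3 (a + a') (b + b') (G\<lparr>edges := E \<union> E'\<rparr>) (D \<union> D')"
proof -
  let ?C = "\<lambda>c D. {H \<in> D. cycle_of_length c H}"
  have dec: "decomposition (G\<lparr>edges := E\<rparr>) D" "decomposition (G\<lparr>edges := E'\<rparr>) D'"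
    using CD by (auto simp: CD_2_3_def)
  have part: "partition_on E (edges ` D)" "partition_on E' (edges ` D')"
    and inj: "inj_on edges D" "inj_on edges D'"
    using dec by (simp_all add: decomposition_def)
  have finD: "finite D" "finite D'"
    using finite_imageD[OF finite_elements[OF fin(1) part(1)] inj(1)]
      finite_imageD[OF finite_elements[OF fin(2) part(2)] inj(2)] .
  have sub: "edges H \<subseteq> E" if "H \<in> D" for H
    using dec(1) that by (auto simp: decomposition_def subgraph_def)
  have sub': "edges H \<subseteq> E'" if "H \<in> D'" for H
    using dec(2) that by (auto simp: decomposition_def subgraph_def)
  have ne: "edges H \<noteq> {}" if "H \<in> D \<union> D'" for H
    using part that by (auto simp: partition_on_def)
  have apart: "edges H \<noteq> edges H'" if "H \<in> D" "H' \<in> D'" for H H'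
    using sub[OF that(1)] sub'[OF that(2)] ne[of H] disj that by blast
  have "inj_on edges (D \<union> D')"
    using inj apart by (auto simp: inj_on_Un)
  moreover have "partition_on (E \<union> E') (edges ` (D \<union> D'))"
    using part disj unfolding partition_on_def image_Un
    by (simp add: disjoint_union)
  moreover have "\<forall>H \<in> D \<union> D'. subgraph H (G\<lparr>edges := E \<union> E'\<rparr>)"
    using dec by (auto simp: decomposition_def subgraph_def)
  ultimately have "decomposition (G\<lparr>edges := E \<union> E'\<rparr>) (D \<union> D')"
    by (simp add: decomposition_def)
  moreover have "card (?C c (D \<union> D')) = card (?C c D) + card (?C c D')" for c
  proof -
    have "?C c (D \<union> D') = ?C c D \<union> ?C c D'" "?C c D \<inter> ?C c D' = {}"
      using apart by auto
    then show ?thesis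
      using finD by (simp add: card_Un_disjoint)
  qed
  ultimately show ?thesis
    using CD by (auto simp: CD_2_3_def)
qed

lemma decomposition_single_cycle:
  assumes "cycle_of_length c C" "subgraph C G"
  shows "decomposition (G\<lparr>edges := edges C\<rparr>) {C}"
  using assms by (auto simp: cycle_of_length_def decomposition_def subgraph_def partition_on_def)

lemma CD_2_3_single_2_cycle:
  assumes "cycle_of_length 2 C" "subgraph C G"
  shows "CD_2_3 1 0 (G\<lparr>edges := edges C\<rparr>) {C}"
proof -
  have "{H \<in> {C}. cycle_of_length 2 H} = {C}" "{H \<in> {C}. cycle_of_length 3 H} = {}"
    using assms by (auto dest: cycle_lengths_exclusive)
  then show ?thesis
    using assms decomposition_single_cycle[OF assms] unfolding CD_2_3_def by simp
qed

lemma CD_2_3_single_3_cycle: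
  assumes "cycle_of_length 3 C" "subgraph C G"
  shows "CD_2_3 0 1 (G\<lparr>edges := edges C\<rparr>) {C}"
proof -
  have "{H \<in> {C}. cycle_of_length 3 H} = {C}" "{H \<in> {C}. cycle_of_length 2 H} = {}"
    using assms by (auto dest: cycle_lengths_exclusive)
  then show ?thesis
    using assms decomposition_single_cycle[OF assms] unfolding CD_2_3_def by simp
qed

section \<open>Cycles of length 2 and 3\<close>

lemma connectedI_adjacent:
  assumes "verts G \<noteq> {}"
    and "\<And>u v. u \<in> verts G \<Longrightarrow> v \<in> verts G \<Longrightarrow> u \<noteq> v \<Longrightarrow> edges_between G u v \<noteq> {}"
  shows "connected G"
  unfolding connected_def
proof (intro conjI ballI)
  fix u v assume "u \<in> verts G" "v \<in> verts G"
  then show "(\<lambda>x y. edges_between G x y \<noteq> {})\<^sup>*\<^sup>* u v"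
    using assms(2)[of u v] by (cases "u = v") auto
qed (fact assms(1))

lemma parallel_pair_is_cycle:
  assumes "u \<noteq> v" "e \<noteq> f" "h e = {u, v}" "h f = {u, v}"
  shows "cycle_of_length 2 \<lparr>verts = {u, v}, edges = {e, f}, ends = h\<rparr>"
proof -
  have "{x \<in> {e, f}. w \<in> h x} = {e, f}" if "w \<in> {u, v}" for w
    using assms that by auto
  then have "degree \<lparr>verts = {u, v}, edges = {e, f}, ends = h\<rparr> w = 2" if "w \<in> {u, v}" for w
    using assms that by (simp add: degree_def)
  moreover have "connected \<lparr>verts = {u, v}, edges = {e, f}, ends = h\<rparr>"
    using assms by (intro connectedI_adjacent) (auto simp: edges_between_def insert_commute)
  ultimately show ?thesis
    using assms by (simp add: cycle_of_length_def multigraph_def)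
qed

lemma triangle_is_cycle:
  assumes "x \<noteq> y" "y \<noteq> z" "x \<noteq> z" "h e = {x, y}" "h f = {y, z}" "h g = {x, z}"
  shows "cycle_of_length 3 \<lparr>verts = {x, y, z}, edges = {e, f, g}, ends = h\<rparr>"
proof -
  have ne: "e \<noteq> f" "f \<noteq> g" "e \<noteq> g"
    using assms by (auto simp: doubleton_eq_iff)
  have "{i \<in> {e, f, g}. x \<in> h i} = {e, g}" "{i \<in> {e, f, g}. y \<in> h i} = {e, f}"
    "{i \<in> {e, f, g}. z \<in> h i} = {f, g}"
    using assms by auto
  then have "degree \<lparr>verts = {x, y, z}, edges = {e, f, g}, ends = h\<rparr> w = 2"
    if "w \<in> {x, y, z}" for w
    using ne that by (auto simp: degree_def)
  moreover have "connected \<lparr>verts = {x, y, z}, edges = {e, f, g}, ends = h\<rparr>"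
  proof (rule connectedI_adjacent, simp, unfold mgraph.select_convs)
    fix u v assume "u \<in> {x, y, z}" "v \<in> {x, y, z}" "u \<noteq> v"
    then have "{u, v} \<in> h ` {e, f, g}"
      using pair_among_three[of u x y z v] assms(4-) by simp
    then obtain i where "i \<in> {e, f, g}" "h i = {u, v}"
      by (metis imageE)
    then have "i \<in> edges_between \<lparr>verts = {x, y, z}, edges = {e, f, g}, ends = h\<rparr> u v"
      by (simp add: edges_between_def)
    then show "edges_between \<lparr>verts = {x, y, z}, edges = {e, f, g}, ends = h\<rparr> u v \<noteq> {}"
      by blast
  qed
  ultimately show ?thesis
    using assms ne by (auto simp: cycle_of_length_def multigraph_def)
qed

section \<open>Decomposing $\mu K_3$\<close>

text \<open>Any two parallel edges already form a cycle, so an even number of them can be removed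
  two at a time, in any order.\<close>

lemma CD_2_3_parallel:
  assumes uv: "u \<in> verts G" "v \<in> verts G" "u \<noteq> v"
    and "F \<subseteq> edges_between G u v" "finite F" "card F = 2 * k"
  shows "\<exists>D. CD_2_3 k 0 (G\<lparr>edges := F\<rparr>) D"
  using assms(4-)
proof (induction k arbitrary: F)
  case 0
  then show ?case
    using CD_2_3_empty by fastforce
next
  case (Suc k)
  have "2 \<le> card F"
    using Suc.prems by simp
  then obtain P where P: "P \<subseteq> F" "card P = 2"
    by (metis obtain_subset_with_card_n)
  then obtain e f where ef: "P = {e, f}" "e \<noteq> f"
    by (auto simp: card_2_iff)
  let ?C = "\<lparr>verts = {u, v}, edges = {e, f}, ends = ends G\<rparr>"
  have C: "cycle_of_length 2 ?C"
    using P ef Suc.prems uv by (intro parallel_pair_is_cycle) (auto simp: edges_between_def)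
  then have "subgraph ?C G"
    using P ef Suc.prems uv by (auto simp: subgraph_def cycle_of_length_def edges_between_def)
  then have 1: "CD_2_3 1 0 (G\<lparr>edges := P\<rparr>) {?C}"
    using CD_2_3_single_2_cycle[OF C] ef by simp
  have "card (F - P) = 2 * k"
    using P Suc.prems by (simp add: card_Diff_subset finite_subset)
  then obtain D where "CD_2_3 k 0 (G\<lparr>edges := F - P\<rparr>) D"
    using Suc.IH[of "F - P"] Suc.prems by auto
  then have "CD_2_3 (1 + k) (0 + 0) (G\<lparr>edges := P \<union> (F - P)\<rparr>) ({?C} \<union> D)"
    using 1 Suc.prems P by (intro CD_2_3_Un) (auto intro: finite_subset)
  moreover have "P \<union> (F - P) = F"
    using P by auto
  ultimately show ?case
    by auto
qed

text \<open>One edge from each of the three classes, chosen arbitrarily, always closes up to a cycle;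
  taking such triples away keeps the three classes equally large.\<close>

lemma CD_2_3_triangles:
  assumes xyz: "{x, y, z} \<subseteq> verts G" "x \<noteq> y" "y \<noteq> z" "x \<noteq> z"
    and "X \<subseteq> edges_between G x y" "Y \<subseteq> edges_between G y z" "Z \<subseteq> edges_between G x z"
    and "finite X" "finite Y" "finite Z" "card X = b" "card Y = b" "card Z = b"
  shows "\<exists>D. CD_2_3 0 b (G\<lparr>edges := X \<union> Y \<union> Z\<rparr>) D"
  using assms(5-)
proof (induction b arbitrary: X Y Z)
  case 0
  then show ?case
    using CD_2_3_empty by fastforce
next
  case (Suc b)
  obtain e f g where efg: "e \<in> X" "f \<in> Y" "g \<in> Z"
    using Suc.prems(7-9) by (auto dest!: card_eq_SucD)
  then have "e \<in> edges_between G x y" "f \<in> edges_between G y z" "g \<in> edges_between G x z"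
    using Suc.prems(1-3) by blast+
  then have E: "e \<in> edges G" "f \<in> edges G" "g \<in> edges G"
    and ends: "ends G e = {x, y}" "ends G f = {y, z}" "ends G g = {x, z}"
    by (simp_all add: edges_between_def)
  let ?C = "\<lparr>verts = {x, y, z}, edges = {e, f, g}, ends = ends G\<rparr>"
  let ?F = "X - {e} \<union> (Y - {f}) \<union> (Z - {g})"
  have C: "cycle_of_length 3 ?C"
    using triangle_is_cycle[where h = "ends G", OF xyz(2-) ends] .
  then have "subgraph ?C G"
    using E xyz(1) by (simp add: subgraph_def cycle_of_length_def)
  then have 1: "CD_2_3 0 1 (G\<lparr>edges := {e, f, g}\<rparr>) {?C}"
    using CD_2_3_single_3_cycle[OF C] by simp
  obtain D where 2: "CD_2_3 0 b (G\<lparr>edges := ?F\<rparr>) D"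
    using Suc.IH[of "X - {e}" "Y - {f}" "Z - {g}"] Suc.prems efg by auto
  have "X \<inter> Y = {}" "Y \<inter> Z = {}" "X \<inter> Z = {}"
    using Int_mono[OF Suc.prems(1,2)] Int_mono[OF Suc.prems(2,3)] Int_mono[OF Suc.prems(1,3)]
    by (simp_all add: edges_between_disjoint[OF xyz(2-)])
  then have disj: "{e, f, g} \<inter> ?F = {}" and F: "{e, f, g} \<union> ?F = X \<union> Y \<union> Z"
    using efg by auto
  have "CD_2_3 (0 + 0) (1 + b) (G\<lparr>edges := {e, f, g} \<union> ?F\<rparr>) ({?C} \<union> D)"
    using Suc.prems(4-6) by (intro CD_2_3_Un[OF 1 2 _ _ disj]) simp_all
  then have "CD_2_3 0 (Suc b) (G\<lparr>edges := X \<union> Y \<union> Z\<rparr>) ({?C} \<union> D)"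
    unfolding F by simp
  then show ?case
    by blast
qed

lemma CD_2_3_mu_K3:
  assumes K3: "is_mu_K3 \<mu> G" and eq: "2 * a + 3 * b = 3 * \<mu>"
  shows "\<exists>D. CD_2_3 a b G D"
proof -
  have "b \<le> \<mu>" "3 * (\<mu> - b) = 2 * a"
    using eq by simp_all
  moreover from this(2) have "even (3 * (\<mu> - b))"
    by simp
  then have "even (\<mu> - b)"
    by simp
  ultimately obtain k where k: "\<mu> = b + 2 * k"
    by (metis evenE le_add_diff_inverse)
  with eq have a: "a = 3 * k"
    by simp
  obtain x y z where V: "verts G = {x, y, z}" and ne: "x \<noteq> y" "y \<noteq> z" "x \<noteq> z"
    using K3 by (auto simp: is_mu_K3_def card_3_iff)
  let ?B = "edges_between G"
  have fin: "finite (?B u v)" for u v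
    using K3 by (auto simp: is_mu_K3_def multigraph_def edges_between_def)
  have card: "card (?B u v) = b + 2 * k" if "{u, v} \<subseteq> {x, y, z}" "u \<noteq> v" for u v
    using K3 V that k by (auto simp: is_mu_K3_def)
  have "\<exists>X \<subseteq> ?B u v. card X = b" if "{u, v} \<subseteq> {x, y, z}" "u \<noteq> v" for u v
    using card[OF that] obtain_subset_with_card_n[of b "?B u v"] by (metis le_add1)
  from this[of x y] this[of y z] this[of x z]
  obtain X Y Z where sub: "X \<subseteq> ?B x y" "Y \<subseteq> ?B y z" "Z \<subseteq> ?B x z"
    and b: "card X = b" "card Y = b" "card Z = b"
    using ne by auto
  have fins: "finite X" "finite Y" "finite Z"
    using sub fin finite_subset by blast+
  have rest: "\<exists>D. CD_2_3 k 0 (G\<lparr>edges := ?B u v - W\<rparr>) D"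
    if "{u, v} \<subseteq> {x, y, z}" "u \<noteq> v" "W \<subseteq> ?B u v" "card W = b" "finite W" for u v W
  proof (rule CD_2_3_parallel)
    show "card (?B u v - W) = 2 * k"
      using that card[of u v] by (simp add: card_Diff_subset)
  qed (use that V fin in auto)
  obtain T where T: "CD_2_3 0 b (G\<lparr>edges := X \<union> Y \<union> Z\<rparr>) T"
    using CD_2_3_triangles[of x y z G X Y Z b] V ne sub b fins by auto
  obtain P where P: "CD_2_3 k 0 (G\<lparr>edges := ?B x y - X\<rparr>) P"
    using rest[of x y X] ne sub b fins by auto
  obtain Q where Q: "CD_2_3 k 0 (G\<lparr>edges := ?B y z - Y\<rparr>) Q"
    using rest[of y z Y] ne sub b fins by auto
  obtain R where R: "CD_2_3 k 0 (G\<lparr>edges := ?B x z - Z\<rparr>) R"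
    using rest[of x z Z] ne sub b fins by auto
  note disj = edges_between_disjoint[OF ne, of G]
  have TP: "CD_2_3 (0 + k) (b + 0) (G\<lparr>edges := X \<union> Y \<union> Z \<union> (?B x y - X)\<rparr>) (T \<union> P)"
    using disj sub fins fin by (intro CD_2_3_Un[OF T P]) auto
  have TPQ: "CD_2_3 (0 + k + k) (b + 0 + 0)
      (G\<lparr>edges := X \<union> Y \<union> Z \<union> (?B x y - X) \<union> (?B y z - Y)\<rparr>) (T \<union> P \<union> Q)"
    using disj sub fins fin by (intro CD_2_3_Un[OF TP Q]) auto
  have TPQR: "CD_2_3 (0 + k + k + k) (b + 0 + 0 + 0)
      (G\<lparr>edges := X \<union> Y \<union> Z \<union> (?B x y - X) \<union> (?B y z - Y) \<union> (?B x z - Z)\<rparr>) (T \<union> P \<union> Q \<union> R)"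
    using disj sub fins fin by (intro CD_2_3_Un[OF TPQ R]) auto
  have "X \<union> Y \<union> Z \<union> (?B x y - X) \<union> (?B y z - Y) \<union> (?B x z - Z) =
      (X \<union> (?B x y - X)) \<union> (Y \<union> (?B y z - Y)) \<union> (Z \<union> (?B x z - Z))"
    by (simp only: Un_ac)
  also have "\<dots> = ?B x y \<union> ?B y z \<union> ?B x z"
    using sub by (simp only: Un_Diff_cancel Un_absorb1)
  also have "\<dots> = edges G"
    using edges_three_vertices[of G x y z] K3 V by (simp add: is_mu_K3_def)
  finally have "X \<union> Y \<union> Z \<union> (?B x y - X) \<union> (?B y z - Y) \<union> (?B x z - Z) = edges G" .
  then have "CD_2_3 a b G (T \<union> P \<union> Q \<union> R)"
    using TPQR a by (simp add: numeral_3_eq_3 add.assoc)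
  then show ?thesis
    by blast
qed

theorem lemma5p2:
  fixes G :: "('v, 'e) mgraph" and \<mu> a b :: nat
  assumes "\<mu> > 0" and "is_mu_K3 \<mu> G"
  shows "(\<exists>D. CD_2_3 a b G D) \<longleftrightarrow> 2 * a + 3 * b = 3 * \<mu>"
proof
  assume "\<exists>D. CD_2_3 a b G D"
  then show "2 * a + 3 * b = 3 * \<mu>"
    using assms(2) card_edges_CD_2_3[of a b G] card_edges_mu_K3[of \<mu> G]
    by (auto simp: is_mu_K3_def multigraph_def)
next
  assume "2 * a + 3 * b = 3 * \<mu>"
  then show "\<exists>D. CD_2_3 a b G D"
    using CD_2_3_mu_K3 assms(2) by blast
qed

end
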